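(* Let $G$ be an edge-colored directed graph (with edges colored by the standard basis vectors $e_1,\dots,e_k$ of $\mathbb{N}^k$) with path category $G^*$, and suppose $\sim$ is an $(r,s,d)$-preserving equivalence relation on $G^*$ satisfying (KG0). The relation $\sim$ satisfies (KG1), (KG2) and (KG3) (and hence $G^*/\sim$ is a $k$-graph) if and only if $\sim$ satisfies (KG4). (The conditions (KG0)–(KG4) are written out in the context.)
   Context: Fix an integer $k\ge 1$; $0\in\mathbb{N}$; $e_1,\dots,e_k$ are the standard basis vectors of $\mathbb{N}^k$, and $\mathbb{N}^k$ is regarded as a category with one object, composition being addition. For $n=\sum n_ie_i$ write $|n|=\sum_i n_i$. A $k$-graph is a countable category $\Lambda$ with a functor $d:\Lambda\to\mathbb{N}^k$ satisfying the factorization rule: for every morphism $\lambda$ and $n,m\in\mathbb{N}^k$ with $d(\lambda)=n+m$ there exist unique $\mu,\nu\in\Lambda$ with $d(\mu)=m$, $d(\nu)=n$ and $\lambda=\mu\nu$. An edge-colored ($k$-colored) directed graph $G=(G^0,G^1,r,s)$ is a directed graph with range and source maps $r,s:G^1\to G^0$ in which each edge $f$ is assigned a color $d(f)\in\{e_1,\dots,e_k\}$. $G^n$ is the set of paths of length $n$; a path is written $f_n\cdots f_1$ with $s(f_{i})=r(f_{i-1})$ (so $f_1$ is the initial edge and $f_n$ the final edge). $G^*=\bigcup_{n\in\mathbb{N}}G^n$ is the path category (vertices are paths of length $0$), with $r,s$ extended in the usual way and $d(f_n\cdots f_1)=\sum_i d(f_i)$, $d(v)=0$ for vertices $v$. $(r,s,d)$-preserving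 means that $\lambda\sim\mu$ implies $r(\lambda)=r(\mu)$, $s(\lambda)=s(\mu)$, $d(\lambda)=d(\mu)$. $[\lambda]$ is the class of $\lambda$. $G^*/\sim$ is given the composition induced by concatenation and the degree functor induced by $d$. The color order of a path $\lambda=\lambda_{n}\cdots\lambda_1$ is the tuple $(d(\lambda_1),\dots,d(\lambda_n))$. (KG0) If $\lambda\in G^*$ is a path with $\lambda=\lambda_2\lambda_1$, then $[\lambda]=[p_2p_1]$ whenever $p_1\in[\lambda_1]$ and $p_2\in[\lambda_2]$. (KG1) If $f,g\in G^1$ are edges, then $f\sim g\Leftrightarrow f=g$. (KG2) For every $\mu=\mu_2\mu_1\in G^2$ with $d(\mu_1)=e_i$, $d(\mu_2)=e_j$ there exists a unique $\nu=\nu_2\nu_1\in G^2$ such that $d(\nu_1)=e_j$, $d(\nu_2)=e_i$ and $\mu\sim\nu$. (KG3) For any path $abc\in G^3$ whose three edges have distinct colors $e_i,e_j,e_\ell$, the two paths with reversed color order obtained as follows are equal, where each replacement of a two-edge path is by the unique equivalent two-edge path with the two colors interchanged, as in (KG2). Route 1: let $ab\sim de$, so $abc\sim dec$; let $ec\sim fg$, so $abc\sim dfg$; let $df\sim hj$, so $abc\sim hjg$. Route 2: let $bc\sim km$, so $abc\sim akm$; let $ak\sim np$, so $abc\sim npm$; let $pm\sim rq$, so $abc\sim nrq$. The condition is that $hjg=nrq$ as paths. (KG4) For each $\lambda\in G^*$ and each permutation of the color order of $\lambda$, there is a unique path $\mu\in[\lambda]$ with the permuted color order.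
   Formalization: Next to (KG1)–(KG3) the formal statement also requires that ∼ be generated, via (KG0), by its identifications of paths of length at most 2 (false otherwise; implied by (KG4)); that G*/∼ is a k-graph is stated for G with countably many vertices and edges. *)

theory Defs
  imports
    "HOL-Analysis.Finite_Cartesian_Product"
    "HOL-Library.Countable_Set"
    "HOL-Combinatorics.Permutations"
    "Graph_Theory.Arc_Walk"
begin

section \<open>k-graphs\<close>

record ('o, 'm) category =
  Obj :: "'o set"
  Mor :: "'m set"
  Dom :: "'m \<Rightarrow> 'o"
  Cod :: "'m \<Rightarrow> 'o"
  Ident :: "'o \<Rightarrow> 'm"
  Comp :: "'m \<Rightarrow> 'm \<Rightarrow> 'm"

text \<open>\<open>Comp C \<mu> \<nu>\<close> is the composite \<open>\<mu>\<nu>\<close>, first \<open>\<nu>\<close> and then \<open>\<mu>\<close>; it is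
  meaningful only if \<open>Dom C \<mu> = Cod C \<nu>\<close>.\<close>

locale small_category =
  fixes C :: "('o, 'm) category"
  assumes Dom_Obj: "\<mu> \<in> Mor C \<Longrightarrow> Dom C \<mu> \<in> Obj C"
    and Cod_Obj: "\<mu> \<in> Mor C \<Longrightarrow> Cod C \<mu> \<in> Obj C"
    and Ident_Mor: "v \<in> Obj C \<Longrightarrow> Ident C v \<in> Mor C"
    and Dom_Ident: "v \<in> Obj C \<Longrightarrow> Dom C (Ident C v) = v"
    and Cod_Ident: "v \<in> Obj C \<Longrightarrow> Cod C (Ident C v) = v"
    and Comp_Mor: "\<lbrakk>\<mu> \<in> Mor C; \<nu> \<in> Mor C; Dom C \<mu> = Cod C \<nu>\<rbrakk> \<Longrightarrow> Comp C \<mu> \<nu> \<in> Mor C"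
    and Dom_Comp: "\<lbrakk>\<mu> \<in> Mor C; \<nu> \<in> Mor C; Dom C \<mu> = Cod C \<nu>\<rbrakk> \<Longrightarrow> Dom C (Comp C \<mu> \<nu>) = Dom C \<nu>"
    and Cod_Comp: "\<lbrakk>\<mu> \<in> Mor C; \<nu> \<in> Mor C; Dom C \<mu> = Cod C \<nu>\<rbrakk> \<Longrightarrow> Cod C (Comp C \<mu> \<nu>) = Cod C \<mu>"
    and Comp_Ident_right: "\<mu> \<in> Mor C \<Longrightarrow> Comp C \<mu> (Ident C (Dom C \<mu>)) = \<mu>"
    and Comp_Ident_left: "\<mu> \<in> Mor C \<Longrightarrow> Comp C (Ident C (Cod C \<mu>)) \<mu> = \<mu>"
    and Comp_assoc: "\<lbrakk>\<mu> \<in> Mor C; \<nu> \<in> Mor C; \<xi> \<in> Mor C; Dom C \<mu> = Cod C \<nu>; Dom C \<nu> = Cod C \<xi>\<rbrakk>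
      \<Longrightarrow> Comp C (Comp C \<mu> \<nu>) \<xi> = Comp C \<mu> (Comp C \<nu> \<xi>)"

text \<open>The index set of the colors is a finite type \<open>'k\<close>, so the number of colors is
  \<open>CARD('k) \<ge> 1\<close>, the monoid of degrees is \<open>nat ^ 'k\<close> and the standard basis vectors are
  the \<open>axis i 1\<close>.\<close>

locale k_graph = small_category C
  for C :: "('o, 'm) category" and \<delta> :: "'m \<Rightarrow> nat ^ 'k::finite" +
  assumes countable_Obj: "countable (Obj C)"
    and countable_Mor: "countable (Mor C)"
    and degree_Ident: "v \<in> Obj C \<Longrightarrow> \<delta> (Ident C v) = 0"
    and degree_Comp: "\<lbrakk>\<mu> \<in> Mor C; \<nu> \<in> Mor C; Dom C \<mu> = Cod C \<nu>\<rbrakk> \<Longrightarrow> \<delta> (Comp C \<mu> \<nu>) = \<delta> \<mu> + \<delta> \<nu>"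
    and factorization: "\<lbrakk>\<kappa> \<in> Mor C; \<delta> \<kappa> = n + m\<rbrakk> \<Longrightarrow>
      \<exists>!(\<mu>, \<nu>). \<mu> \<in> Mor C \<and> \<nu> \<in> Mor C \<and> Dom C \<mu> = Cod C \<nu> \<and>
        \<delta> \<mu> = m \<and> \<delta> \<nu> = n \<and> \<kappa> = Comp C \<mu> \<nu>"

section \<open>Edge-colored directed graphs and their path categories\<close>

locale colored_digraph = wf_digraph G
  for G :: "('v, 'e) pre_digraph" and d :: "'e \<Rightarrow> nat ^ 'k::finite" +
  assumes color: "f \<in> arcs G \<Longrightarrow> \<exists>i. d f = axis i 1"

text \<open>A path is a triple \<open>(u, p, v)\<close> consisting of its source \<open>u\<close>, the list \<open>p\<close> of its edges in
  the order in which they are traversed, and its range \<open>v\<close>. Thus \<open>f\<^sub>n \<dots> f\<^sub>1\<close> is represented with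
  the list \<open>[f\<^sub>1, \<dots>, f\<^sub>n]\<close>, and a vertex \<open>v\<close> is the path \<open>(v, [], v)\<close>.\<close>

type_synonym ('v, 'e) path = "'v \<times> 'e list \<times> 'v"

definition psrc :: "('v, 'e) path \<Rightarrow> 'v" where
  "psrc \<kappa> = fst \<kappa>"

definition pedges :: "('v, 'e) path \<Rightarrow> 'e list" where
  "pedges \<kappa> = fst (snd \<kappa>)"

definition prng :: "('v, 'e) path \<Rightarrow> 'v" where
  "prng \<kappa> = snd (snd \<kappa>)"

definition gpaths :: "('v, 'e) pre_digraph \<Rightarrow> ('v, 'e) path set" where
  "gpaths G = {(u, p, v). pre_digraph.awalk G u p v}"

definition gpaths_len :: "('v, 'e) pre_digraph \<Rightarrow> nat \<Rightarrow> ('v, 'e) path set" where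
  "gpaths_len G n = {\<kappa> \<in> gpaths G. length (pedges \<kappa>) = n}"

definition vpath :: "'v \<Rightarrow> ('v, 'e) path" where
  "vpath v = (v, [], v)"

definition epath :: "('v, 'e) pre_digraph \<Rightarrow> 'e \<Rightarrow> ('v, 'e) path" where
  "epath G f = (tail G f, [f], head G f)"

text \<open>\<open>\<kappa>\<^sub>2 \<cdot> \<kappa>\<^sub>1\<close> is the concatenation \<open>\<kappa>\<^sub>2\<kappa>\<^sub>1\<close> in which \<open>\<kappa>\<^sub>1\<close> is traversed first; it is a path only
  if \<open>psrc \<kappa>\<^sub>2 = prng \<kappa>\<^sub>1\<close>.\<close>

definition pcomp :: "('v, 'e) path \<Rightarrow> ('v, 'e) path \<Rightarrow> ('v, 'e) path" (infixr "\<cdot>" 75) where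
  "\<kappa>\<^sub>2 \<cdot> \<kappa>\<^sub>1 = (psrc \<kappa>\<^sub>1, pedges \<kappa>\<^sub>1 @ pedges \<kappa>\<^sub>2, prng \<kappa>\<^sub>2)"

definition color_order :: "('e \<Rightarrow> nat ^ 'k::finite) \<Rightarrow> ('v, 'e) path \<Rightarrow> (nat ^ 'k) list" where
  "color_order d \<kappa> = map d (pedges \<kappa>)"

definition pdegree :: "('e \<Rightarrow> nat ^ 'k::finite) \<Rightarrow> ('v, 'e) path \<Rightarrow> nat ^ 'k" where
  "pdegree d \<kappa> = sum_list (map d (pedges \<kappa>))"

section \<open>The conditions on the equivalence relation\<close>

text \<open>The relation is a set \<open>R\<close> of pairs of paths, and \<open>R `` {\<kappa>}\<close> is the class \<open>[\<kappa>]\<close>.\<close>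

definition rsd_preserving :: "('e \<Rightarrow> nat ^ 'k::finite) \<Rightarrow> ('v, 'e) path rel \<Rightarrow> bool" where
  "rsd_preserving d R \<longleftrightarrow>
    (\<forall>(\<kappa>, \<mu>) \<in> R. prng \<kappa> = prng \<mu> \<and> psrc \<kappa> = psrc \<mu> \<and> pdegree d \<kappa> = pdegree d \<mu>)"

definition KG0 :: "('v, 'e) pre_digraph \<Rightarrow> ('v, 'e) path rel \<Rightarrow> bool" where
  "KG0 G R \<longleftrightarrow>
    (\<forall>\<kappa>\<^sub>1 \<in> gpaths G. \<forall>\<kappa>\<^sub>2 \<in> gpaths G. psrc \<kappa>\<^sub>2 = prng \<kappa>\<^sub>1 \<longrightarrow>
      (\<forall>p\<^sub>1 \<in> R `` {\<kappa>\<^sub>1}. \<forall>p\<^sub>2 \<in> R `` {\<kappa>\<^sub>2}. R `` {\<kappa>\<^sub>2 \<cdot> \<kappa>\<^sub>1} = R `` {p\<^sub>2 \<cdot> p\<^sub>1}))"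

definition KG1 :: "('v, 'e) pre_digraph \<Rightarrow> ('v, 'e) path rel \<Rightarrow> bool" where
  "KG1 G R \<longleftrightarrow> (\<forall>f \<in> arcs G. \<forall>g \<in> arcs G. (epath G f, epath G g) \<in> R \<longleftrightarrow> f = g)"

definition KG2 ::
  "('v, 'e) pre_digraph \<Rightarrow> ('e \<Rightarrow> nat ^ 'k::finite) \<Rightarrow> ('v, 'e) path rel \<Rightarrow> bool" where
  "KG2 G d R \<longleftrightarrow>
    (\<forall>\<mu> \<in> gpaths_len G 2. \<forall>i j. color_order d \<mu> = [axis i 1, axis j 1] \<longrightarrow>
      (\<exists>!\<nu>. \<nu> \<in> gpaths_len G 2 \<and> color_order d \<nu> = [axis j 1, axis i 1] \<and> (\<mu>, \<nu>) \<in> R))"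

text \<open>\<open>swap2 G d R a b x y\<close>: the two-edge path \<open>xy\<close> is equivalent to \<open>ab\<close> and has the two colors
  of \<open>ab\<close> interchanged. Under \<open>KG2\<close>, the path \<open>xy\<close> is determined by \<open>ab\<close>.\<close>

definition swap2 ::
  "('v, 'e) pre_digraph \<Rightarrow> ('e \<Rightarrow> nat ^ 'k::finite) \<Rightarrow> ('v, 'e) path rel \<Rightarrow>
    'e \<Rightarrow> 'e \<Rightarrow> 'e \<Rightarrow> 'e \<Rightarrow> bool" where
  "swap2 G d R a b x y \<longleftrightarrow>
    epath G x \<cdot> epath G y \<in> gpaths_len G 2 \<and>
    (epath G a \<cdot> epath G b, epath G x \<cdot> epath G y) \<in> R \<and> d x = d b \<and> d y = d a"

definition KG3 ::
  "('v, 'e) pre_digraph \<Rightarrow> ('e \<Rightarrow> nat ^ 'k::finite) \<Rightarrow> ('v, 'e) path rel \<Rightarrow> bool" where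
  "KG3 G d R \<longleftrightarrow>
    (\<forall>a b c. {a, b, c} \<subseteq> arcs G \<and> tail G a = head G b \<and> tail G b = head G c \<and>
        distinct [d a, d b, d c] \<longrightarrow>
      (\<forall>d' e f g h j k m n p r q.
        swap2 G d R a b d' e \<and> swap2 G d R e c f g \<and> swap2 G d R d' f h j \<and>
        swap2 G d R b c k m \<and> swap2 G d R a k n p \<and> swap2 G d R p m r q \<longrightarrow>
        epath G h \<cdot> epath G j \<cdot> epath G g = epath G n \<cdot> epath G r \<cdot> epath G q))"

definition KG4 ::
  "('v, 'e) pre_digraph \<Rightarrow> ('e \<Rightarrow> nat ^ 'k::finite) \<Rightarrow> ('v, 'e) path rel \<Rightarrow> bool" where
  "KG4 G d R \<longleftrightarrow>
    (\<forall>\<kappa> \<in> gpaths G. \<forall>\<sigma>. \<sigma> permutes {..<length (color_order d \<kappa>)} \<longrightarrow>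
      (\<exists>!\<mu>. \<mu> \<in> R `` {\<kappa>} \<and> color_order d \<mu> = permute_list \<sigma> (color_order d \<kappa>)))"

text \<open>\<open>R\<close> is the least degree-preserving congruence that makes its own identifications of paths of
  length at most two. This is how such relations arise from a collection of commuting squares.
  It does not follow from \<open>KG1\<close>, \<open>KG2\<close>, \<open>KG3\<close>, none of which restricts the identifications of two
  different paths of length at least three with the same color order. For instance, if \<open>G\<close> has one
  vertex and two loops of the same color, then identifying all paths of equal length
  \<open>n \<ge> 3\<close>, and nothing else, satisfies \<open>KG0\<close> to \<open>KG3\<close> but not \<open>KG4\<close>.\<close>

definition generated_by_squares ::
  "('v, 'e) pre_digraph \<Rightarrow> ('e \<Rightarrow> nat ^ 'k::finite) \<Rightarrow> ('v, 'e) path rel \<Rightarrow> bool" where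
  "generated_by_squares G d R \<longleftrightarrow>
    (\<forall>S. equiv (gpaths G) S \<and> rsd_preserving d S \<and> KG0 G S \<and>
        (\<forall>(\<kappa>, \<mu>) \<in> R. length (pedges \<kappa>) \<le> 2 \<longrightarrow> (\<kappa>, \<mu>) \<in> S) \<longrightarrow> R \<subseteq> S)"

section \<open>The quotient of the path category\<close>

text \<open>The classes of the vertices are identified with the vertices, which is possible for an
  \<open>rsd_preserving\<close> relation. On a class, source, range and degree are the common values of its
  members.\<close>

definition path_quotient ::
  "('v, 'e) pre_digraph \<Rightarrow> ('v, 'e) path rel \<Rightarrow> ('v, ('v, 'e) path set) category" where
  "path_quotient G R =
    \<lparr> Obj = verts G,
      Mor = gpaths G // R,
      Dom = (\<lambda>X. the_elem (psrc ` X)),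
      Cod = (\<lambda>X. the_elem (prng ` X)),
      Ident = (\<lambda>v. R `` {vpath v}),
      Comp = (\<lambda>X Y. \<Union>x\<in>X. \<Union>y\<in>Y. R `` {x \<cdot> y}) \<rparr>"

definition quotient_degree :: "('e \<Rightarrow> nat ^ 'k::finite) \<Rightarrow> ('v, 'e) path set \<Rightarrow> nat ^ 'k" where
  "quotient_degree d X = the_elem (pdegree d ` X)"

end

theory Submission
  imports Defs
begin

text \<open>A class of paths has a member with every permuted color order as soon as every two-edge path
  can be replaced by an equivalent one with the colors interchanged: adjacent interchanges produce
  every permutation (\<open>reorder\<close>). What has to be understood is uniqueness.

  Suppose \<open>KG1\<close>, \<open>KG2\<close> and \<open>KG3\<close>. Order the colors linearly and sort the edges of a path by color,
  each step interchanging two adjacent colors that are in the wrong order. Sorting terminates. It is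
  locally confluent: two steps at disjoint places commute, two steps at the same place agree by
  \<open>KG2\<close>, and two steps that overlap in three edges concern three different colors in decreasing
  order, for which \<open>KG3\<close> says that both ways of reversing the order agree. By Newman's lemma sorting
  is confluent, so being sortable to a common path (\<open>joinable\<close>) is an equivalence relation. It is
  compatible with concatenation, and it contains the identifications of paths of length at most two;
  since these generate the given relation, equivalent paths are joinable. Two joinable paths with
  the same color order are equal (\<open>joinable_same_colors_imp_eq\<close>): the same steps sort both of them,
  and every step can be undone. This is the uniqueness in \<open>KG4\<close>.

  Conversely, assume \<open>KG4\<close>. Equivalent paths with the same color order are equal, which gives \<open>KG1\<close>,
  \<open>KG2\<close> and \<open>KG3\<close>. Any congruence \<open>S\<close> containing the short identifications contains the
  interchanges by which a path is brought to the color order of an equivalent path; the result must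
  be that path, so \<open>S\<close> contains the given relation.

  In the quotient, a morphism of degree \<open>n + m\<close> has a unique representative whose color order
  consists of a fixed list of total degree \<open>n\<close> followed by a fixed list of total degree \<open>m\<close>. Cutting
  this representative gives the factorization, and every factorization arises in this way.\<close>

section \<open>Degrees and color multisets\<close>

lemma sum_list_axis_nth:
  fixes l :: "(nat ^ 'k::finite) list"
  assumes "set l \<subseteq> range (\<lambda>i. axis i 1)"
  shows "sum_list l $ i = count (mset l) (axis i 1)"
  using assms
proof (induction l)
  case (Cons a l)
  then obtain j where a: "a = axis j 1" by auto
  have "axis j (1::nat) $ i = (if j = i then 1 else 0)" by (simp add: axis_def)
  with Cons a show ?case by (simp add: axis_eq_axis)
qed simp

text \<open>A multiset of basis vectors is determined by its sum: the multiplicity of \<open>axis i 1\<close> is the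
  \<open>i\<close>-th coordinate.\<close>

lemma mset_eq_of_sum_list_axis:
  fixes l l' :: "(nat ^ 'k::finite) list"
  assumes l: "set l \<subseteq> range (\<lambda>i. axis i 1)" and l': "set l' \<subseteq> range (\<lambda>i. axis i 1)"
    and eq: "sum_list l = sum_list l'"
  shows "mset l = mset l'"
proof (rule multiset_eqI)
  fix a
  show "count (mset l) a = count (mset l') a"
  proof (cases "a \<in> range (\<lambda>i. axis i 1)")
    case True
    then obtain i where "a = axis i 1" by blast
    with sum_list_axis_nth[OF l, of i] sum_list_axis_nth[OF l', of i] eq show ?thesis by simp
  next
    case False
    with l l' show ?thesis
      by (metis count_mset_0_iff subsetD)
  qed
qed

lemma ex_axis_list_of_sum:
  fixes n :: "nat ^ 'k::finite"
  shows "\<exists>l. set l \<subseteq> range (\<lambda>i. axis i 1) \<and> sum_list l = n"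
proof (induction "\<Sum>i\<in>UNIV. n $ i" arbitrary: n)
  case 0
  then have "n = 0" by (simp add: vec_eq_iff)
  then show ?case by (intro exI[of _ "[]"]) simp
next
  case (Suc m)
  have "\<exists>i. n $ i \<noteq> 0"
    using Suc.hyps(2) by (metis nat.distinct(1) sum.neutral)
  then obtain i where i: "n $ i \<noteq> 0" ..
  define n' where "n' = n - axis i 1"
  have n: "n = axis i 1 + n'"
    using i by (auto simp: n'_def vec_eq_iff axis_def)
  have "(\<Sum>j\<in>UNIV. n $ j) = 1 + (\<Sum>j\<in>UNIV. n' $ j)"
    by (subst n) (simp add: sum.distrib axis_def)
  with Suc.hyps(2) have "m = (\<Sum>j\<in>UNIV. n' $ j)" by simp
  from Suc.hyps(1)[OF this] obtain l
    where "set l \<subseteq> range (\<lambda>i. axis i 1)" "sum_list l = n'" by blast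
  then show ?case using n by (intro exI[of _ "axis i 1 # l"]) auto
qed

lemma Ex1_image:
  assumes "inj f"
  shows "(\<exists>!b. \<exists>a. b = f a \<and> P a) \<longleftrightarrow> (\<exists>!a. P a)"
proof
  assume "\<exists>!b. \<exists>a. b = f a \<and> P a"
  then show "\<exists>!a. P a" using injD[OF assms] by blast
qed blast

section \<open>Congruences on the path category\<close>

lemma psrc_simp [simp]: "psrc (u, p, v) = u"
  and pedges_simp [simp]: "pedges (u, p, v) = p"
  and prng_simp [simp]: "prng (u, p, v) = v"
  and pcomp_simp [simp]: "(v', q, w) \<cdot> (u, p, v) = (u, p @ q, w)"
  and color_order_simp [simp]: "color_order d (u, p, v) = map d p"
  and pdegree_simp [simp]: "pdegree d (u, p, v) = sum_list (map d p)"
  by (simp_all add: psrc_def pedges_def prng_def pcomp_def color_order_def pdegree_def)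

lemma mem_gpaths [simp]: "(u, p, v) \<in> gpaths G \<longleftrightarrow> pre_digraph.awalk G u p v"
  by (simp add: gpaths_def)

lemma mem_gpaths_len [simp]:
  "(u, p, v) \<in> gpaths_len G n \<longleftrightarrow> pre_digraph.awalk G u p v \<and> length p = n"
  by (simp add: gpaths_len_def)

lemma (in wf_digraph) awalk_append_ex:
  "awalk u (p @ q) w \<longleftrightarrow> (\<exists>v. awalk u p v \<and> awalk v q w)"
proof (induction p arbitrary: u)
  case Nil
  then show ?case by (auto simp: awalk_Nil_iff intro: awalk_hd_in_verts)
next
  case (Cons e p)
  then show ?case by (simp only: append_Cons awalk_Cons_iff) blast
qed

lemma (in wf_digraph) awalk_unique_range: "awalk u p v \<Longrightarrow> awalk u p w \<Longrightarrow> v = w"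
proof (induction p arbitrary: u)
  case (Cons e p)
  then show ?case by (simp only: awalk_Cons_iff) blast
qed (simp add: awalk_Nil_iff)

lemma KG0I:
  assumes eq: "equiv (gpaths G) R"
    and comp: "\<And>\<kappa>\<^sub>1 \<kappa>\<^sub>2 p\<^sub>1 p\<^sub>2. (\<kappa>\<^sub>1, p\<^sub>1) \<in> R \<Longrightarrow> (\<kappa>\<^sub>2, p\<^sub>2) \<in> R \<Longrightarrow> psrc \<kappa>\<^sub>2 = prng \<kappa>\<^sub>1 \<Longrightarrow>
      (\<kappa>\<^sub>2 \<cdot> \<kappa>\<^sub>1, p\<^sub>2 \<cdot> p\<^sub>1) \<in> R"
  shows "KG0 G R"
  unfolding KG0_def
proof (intro ballI impI)
  fix \<kappa>\<^sub>1 \<kappa>\<^sub>2 p\<^sub>1 p\<^sub>2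
  assume "psrc \<kappa>\<^sub>2 = prng \<kappa>\<^sub>1" "p\<^sub>1 \<in> R `` {\<kappa>\<^sub>1}" "p\<^sub>2 \<in> R `` {\<kappa>\<^sub>2}"
  then have "(\<kappa>\<^sub>2 \<cdot> \<kappa>\<^sub>1, p\<^sub>2 \<cdot> p\<^sub>1) \<in> R" using comp by simp
  then show "R `` {\<kappa>\<^sub>2 \<cdot> \<kappa>\<^sub>1} = R `` {p\<^sub>2 \<cdot> p\<^sub>1}" by (rule equiv_class_eq[OF eq])
qed

text \<open>A degree-preserving congruence on the path category of a colored graph.\<close>

locale path_congruence = colored_digraph G d
  for G :: "('v, 'e) pre_digraph" and d :: "'e \<Rightarrow> nat ^ 'k::finite" +
  fixes R :: "('v, 'e) path rel"
  assumes equiv: "equiv (gpaths G) R"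
    and rsd: "rsd_preserving d R"
    and KG0: "KG0 G R"
begin

lemma colors_axis: "awalk u p v \<Longrightarrow> set (map d p) \<subseteq> range (\<lambda>i. axis i 1)"
  by (auto simp: awalk_def dest!: subsetD color)

lemma R_refl: "awalk u p v \<Longrightarrow> ((u, p, v), (u, p, v)) \<in> R"
  using equiv by (simp add: equiv_def refl_on_def)

lemma R_sym: "(\<kappa>, \<mu>) \<in> R \<Longrightarrow> (\<mu>, \<kappa>) \<in> R"
  using equiv by (meson equivE symE)

lemma R_trans: "(\<kappa>, \<mu>) \<in> R \<Longrightarrow> (\<mu>, \<nu>) \<in> R \<Longrightarrow> (\<kappa>, \<nu>) \<in> R"
  using equiv by (meson equivE transE)

text \<open>Equivalent paths have the same endpoints and the same colors with multiplicity; the latter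
  is what equality of the degrees means.\<close>

lemma R_D:
  assumes "((u, p, v), (u', q, v')) \<in> R"
  shows "awalk u p v" "awalk u' q v'" "u' = u" "v' = v" "mset (map d p) = mset (map d q)"
proof -
  have "R \<subseteq> gpaths G \<times> gpaths G" using equiv by (rule equiv_type)
  then show a: "awalk u p v" "awalk u' q v'" using assms by auto
  have "sum_list (map d p) = sum_list (map d q)" and "u' = u" "v' = v"
    using rsd assms by (auto simp: rsd_preserving_def)
  then show "u' = u" "v' = v" "mset (map d p) = mset (map d q)"
    using a by (simp_all only: mset_eq_of_sum_list_axis colors_axis)
qed

lemma R_length: "((u, p, v), (u', q, v')) \<in> R \<Longrightarrow> length q = length p"
  using R_D(5) by (metis length_map size_mset)

lemma R_append:
  assumes "((u, p, v), (u, p', v)) \<in> R" "((v, q, w), (v, q', w)) \<in> R"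
  shows "((u, p @ q, w), (u, p' @ q', w)) \<in> R"
proof -
  have "R `` {(v, q, w) \<cdot> (u, p, v)} = R `` {(v, q', w) \<cdot> (u, p', v)}"
    using KG0 R_D[OF assms(1)] R_D[OF assms(2)] assms
    unfolding KG0_def by (metis Image_singleton_iff mem_gpaths prng_simp psrc_simp)
  moreover have "awalk u (p' @ q') w"
    using R_D[OF assms(1)] R_D[OF assms(2)] awalk_append_ex by blast
  ultimately show ?thesis using R_refl[of u "p' @ q'" w] by auto
qed

text \<open>\<open>swap x y x' y'\<close>: the path that traverses \<open>x\<close> and then \<open>y\<close> is equivalent to the one that
  traverses \<open>x'\<close> and then \<open>y'\<close>, and the latter has the two colors interchanged. In contrast to
  \<open>swap2\<close>, edges are listed in the order of traversal.\<close>

definition swap :: "'e \<Rightarrow> 'e \<Rightarrow> 'e \<Rightarrow> 'e \<Rightarrow> bool" where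
  "swap x y x' y' \<longleftrightarrow>
    ((tail G x, [x, y], head G y), (tail G x, [x', y'], head G y)) \<in> R \<and> d x' = d y \<and> d y' = d x"

lemma swap_D:
  assumes "swap x y x' y'"
  shows "x \<in> arcs G" "y \<in> arcs G" "head G x = tail G y"
    "x' \<in> arcs G" "y' \<in> arcs G" "head G x' = tail G y'"
    "tail G x' = tail G x" "head G y' = head G y" "d x' = d y" "d y' = d x"
proof -
  have R: "((tail G x, [x, y], head G y), (tail G x, [x', y'], head G y)) \<in> R"
    and "d x' = d y" "d y' = d x"
    using assms by (simp_all only: swap_def)
  with R_D(1,2)[OF R] show "x \<in> arcs G" "y \<in> arcs G" "head G x = tail G y"
    "x' \<in> arcs G" "y' \<in> arcs G" "head G x' = tail G y'"
    "tail G x' = tail G x" "head G y' = head G y" "d x' = d y" "d y' = d x"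
    by (simp_all add: awalk_simps)
qed

lemma swap_sym: "swap x y x' y' \<Longrightarrow> swap x' y' x y"
  using swap_D(7,8)[of x y x' y'] R_sym by (simp add: swap_def)

lemma swap2_iff_swap:
  assumes "tail G a = head G b" "a \<in> arcs G" "b \<in> arcs G"
  shows "swap2 G d R a b x y \<longleftrightarrow> swap b a y x"
proof
  assume s: "swap2 G d R a b x y"
  then have "((tail G b, [b, a], head G a), (tail G y, [y, x], head G x)) \<in> R"
    by (simp add: swap2_def epath_def)
  with R_D(3,4)[OF this] s show "swap b a y x" by (simp add: swap_def swap2_def)
next
  assume s: "swap b a y x"
  then show "swap2 G d R a b x y"
    using swap_D[OF s] by (auto simp: swap_def swap2_def epath_def awalk_simps)
qed

text \<open>Every two-edge path is equivalent to one with the two colors interchanged. This is the existence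
  part of \<open>KG2\<close>.\<close>

definition has_squares :: bool where
  "has_squares \<longleftrightarrow> (\<forall>x \<in> arcs G. \<forall>y \<in> arcs G. head G x = tail G y \<longrightarrow> (\<exists>x' y'. swap x y x' y'))"

lemma bring_color_to_front:
  assumes sq: has_squares and "awalk u p v" "a \<in> set (map d p)"
  shows "\<exists>x q. ((u, p, v), (u, x # q, v)) \<in> R \<and> d x = a"
  using assms(2,3)
proof (induction p arbitrary: u)
  case (Cons z p)
  show ?case
  proof (cases "d z = a")
    case True
    with R_refl[OF Cons.prems(1)] show ?thesis by blast
  next
    case False
    have z: "z \<in> arcs G" "u = tail G z" and p: "awalk (head G z) p v"
      using Cons.prems(1) by (auto simp: awalk_simps)
    obtain y q where yq: "((head G z, p, v), (head G z, y # q, v)) \<in> R" "d y = a"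
      using Cons.IH[OF p] Cons.prems(2) False by auto
    have y: "y \<in> arcs G" "head G z = tail G y" and q: "awalk (head G y) q v"
      using R_D(2)[OF yq(1)] by (auto simp: awalk_simps)
    obtain x' y' where s: "swap z y x' y'"
      using sq z y unfolding has_squares_def by blast
    have "((u, [z], head G z), (u, [z], head G z)) \<in> R"
      using z by (intro R_refl) (simp add: awalk_simps)
    from R_append[OF this yq(1)] have "((u, z # p, v), (u, z # y # q, v)) \<in> R" by simp
    moreover have "((u, [z, y] @ q, v), (u, [x', y'] @ q, v)) \<in> R"
      using s z q by (intro R_append[of _ _ "head G y"] R_refl) (auto simp: swap_def)
    ultimately have "((u, z # p, v), (u, x' # y' # q, v)) \<in> R"
      using R_trans by auto
    with swap_D[OF s] yq(2) show ?thesis by blast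
  qed
qed simp

text \<open>The existence part of \<open>KG4\<close>, by bringing the required colors to the front one after the
  other.\<close>

lemma reorder:
  assumes sq: has_squares
  shows "awalk u p v \<Longrightarrow> mset l = mset (map d p) \<Longrightarrow>
    \<exists>q. ((u, p, v), (u, q, v)) \<in> R \<and> map d q = l"
proof (induction l arbitrary: u p)
  case Nil
  then show ?case using R_refl by auto
next
  case (Cons a l)
  have "a \<in> set (map d p)"
    using Cons.prems(2) by (metis list.set_intros(1) mset_eq_setD)
  then obtain x q where xq: "((u, p, v), (u, x # q, v)) \<in> R" "d x = a"
    using bring_color_to_front[OF sq Cons.prems(1)] by blast
  have w: "x \<in> arcs G" "u = tail G x" "awalk (head G x) q v"
    using R_D(2)[OF xq(1)] by (auto simp: awalk_simps)
  have "mset l = mset (map d q)"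
    using R_D(5)[OF xq(1)] Cons.prems(2) xq(2) by simp
  then obtain q' where q': "((head G x, q, v), (head G x, q', v)) \<in> R" "map d q' = l"
    using Cons.IH[OF w(3)] by blast
  have "((u, [x], head G x), (u, [x], head G x)) \<in> R"
    using w by (intro R_refl) (simp add: awalk_simps)
  from R_append[OF this q'(1)] have "((u, p, v), (u, x # q', v)) \<in> R"
    using xq(1) R_trans by auto
  with q'(2) xq(2) show ?case by (intro exI[of _ "x # q'"]) simp
qed

text \<open>The conditions in terms of edge lists. For \<open>KG4\<close>, the permutations of a color order are the lists
  with the same multiset of colors.\<close>

lemma KG4_iff:
  "KG4 G d R \<longleftrightarrow> (\<forall>u p v l. awalk u p v \<longrightarrow> mset l = mset (map d p) \<longrightarrow>
    (\<exists>!q. ((u, p, v), (u, q, v)) \<in> R \<and> map d q = l))"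
proof -
  have ex1: "(\<exists>!\<mu>. \<mu> \<in> R `` {(u, p, v)} \<and> color_order d \<mu> = l) \<longleftrightarrow>
      (\<exists>!q. ((u, p, v), (u, q, v)) \<in> R \<and> map d q = l)" for u p v l
  proof -
    have "\<mu> \<in> R `` {(u, p, v)} \<and> color_order d \<mu> = l \<longleftrightarrow>
        (\<exists>q. \<mu> = (u, q, v) \<and> ((u, p, v), (u, q, v)) \<in> R \<and> map d q = l)" for \<mu>
      by (cases \<mu>) (auto dest: R_D(3,4))
    then show ?thesis by (simp only: Ex1_image[of "\<lambda>q. (u, q, v)"] inj_def prod.inject simp_thms)
  qed
  have ball_gpaths: "(\<forall>\<kappa> \<in> gpaths G. P \<kappa>) \<longleftrightarrow> (\<forall>u p v. awalk u p v \<longrightarrow> P (u, p, v))" for P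
    by (auto simp: gpaths_def)
  have perm: "(\<forall>\<sigma>. \<sigma> permutes {..<length l} \<longrightarrow> P (permute_list \<sigma> l)) \<longleftrightarrow>
      (\<forall>l'. mset l' = mset l \<longrightarrow> P l')" for P and l :: "(nat ^ 'k) list"
    by (metis mset_eq_permutation mset_permute_list)
  have "KG4 G d R \<longleftrightarrow> (\<forall>\<kappa> \<in> gpaths G. \<forall>l. mset l = mset (color_order d \<kappa>) \<longrightarrow>
      (\<exists>!\<mu>. \<mu> \<in> R `` {\<kappa>} \<and> color_order d \<mu> = l))"
    unfolding KG4_def by (intro ball_cong refl perm)
  also have "\<dots> \<longleftrightarrow> (\<forall>u p v l. awalk u p v \<longrightarrow> mset l = mset (map d p) \<longrightarrow>
    (\<exists>!q. ((u, p, v), (u, q, v)) \<in> R \<and> map d q = l))"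
    unfolding ball_gpaths ex1 color_order_simp by blast
  finally show ?thesis .
qed

lemma KG1_iff:
  "KG1 G R \<longleftrightarrow> (\<forall>u p q v. ((u, p, v), (u, q, v)) \<in> R \<longrightarrow> length p = 1 \<longrightarrow> p = q)"
proof
  assume k: "KG1 G R"
  show "\<forall>u p q v. ((u, p, v), (u, q, v)) \<in> R \<longrightarrow> length p = 1 \<longrightarrow> p = q"
  proof (intro allI impI)
    fix u p q v
    assume R: "((u, p, v), (u, q, v)) \<in> R" and len: "length p = 1"
    with R_length[OF R] obtain f g where fg: "p = [f]" "q = [g]"
      by (auto simp: length_Suc_conv)
    with R_D(1,2)[OF R] have "f \<in> arcs G" "g \<in> arcs G" "epath G f = (u, p, v)" "epath G g = (u, q, v)"
      by (auto simp: awalk_simps epath_def)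
    with k R fg show "p = q" unfolding KG1_def by metis
  qed
next
  assume a: "\<forall>u p q v. ((u, p, v), (u, q, v)) \<in> R \<longrightarrow> length p = 1 \<longrightarrow> p = q"
  show "KG1 G R"
    unfolding KG1_def
  proof (intro ballI iffI)
    fix f g
    assume "(epath G f, epath G g) \<in> R"
    then show "f = g"
      using a[rule_format, of "tail G f" "[f]" "head G f" "[g]"]
        R_D(3,4)[of "tail G f" "[f]" "head G f" "tail G g" "[g]" "head G g"]
      by (simp add: epath_def)
  next
    fix f g
    assume "f \<in> arcs G" "f = g"
    then show "(epath G f, epath G g) \<in> R"
      by (auto simp: epath_def awalk_simps intro!: R_refl)
  qed
qed

lemma KG2_iff:
  "KG2 G d R \<longleftrightarrow> has_squares \<and>
    (\<forall>x y x1 y1 x2 y2. swap x y x1 y1 \<longrightarrow> swap x y x2 y2 \<longrightarrow> x1 = x2 \<and> y1 = y2)"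
proof -
  have eq: "(\<exists>!\<nu>. \<nu> \<in> gpaths_len G 2 \<and> color_order d \<nu> = [d y, d x] \<and>
        ((tail G x, [x, y], head G y), \<nu>) \<in> R) \<longleftrightarrow> (\<exists>!e. swap x y (fst e) (snd e))" for x y
  proof -
    have "\<nu> \<in> gpaths_len G 2 \<and> color_order d \<nu> = [d y, d x] \<and>
        ((tail G x, [x, y], head G y), \<nu>) \<in> R \<longleftrightarrow>
        (\<exists>e. \<nu> = (tail G x, [fst e, snd e], head G y) \<and> swap x y (fst e) (snd e))" for \<nu>
      using R_D(2-4)[of "tail G x" "[x, y]" "head G y" "fst \<nu>" "fst (snd \<nu>)" "snd (snd \<nu>)"]
      by (cases \<nu>) (auto simp: swap_def)
    moreover have "inj (\<lambda>e. (tail G x, [fst e, snd e :: 'e], head G y))"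
      by (auto simp: inj_def)
    ultimately show ?thesis by (simp only: Ex1_image)
  qed
  have "KG2 G d R \<longleftrightarrow> (\<forall>x \<in> arcs G. \<forall>y \<in> arcs G. head G x = tail G y \<longrightarrow>
      (\<exists>!\<nu>. \<nu> \<in> gpaths_len G 2 \<and> color_order d \<nu> = [d y, d x] \<and>
        ((tail G x, [x, y], head G y), \<nu>) \<in> R))"
  proof
    assume k: "KG2 G d R"
    show "\<forall>x \<in> arcs G. \<forall>y \<in> arcs G. head G x = tail G y \<longrightarrow>
      (\<exists>!\<nu>. \<nu> \<in> gpaths_len G 2 \<and> color_order d \<nu> = [d y, d x] \<and>
        ((tail G x, [x, y], head G y), \<nu>) \<in> R)"
    proof (intro ballI impI)
      fix x y
      assume xy: "x \<in> arcs G" "y \<in> arcs G" "head G x = tail G y"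
      with color obtain i j where "d x = axis i 1" "d y = axis j 1" by meson
      then show "\<exists>!\<nu>. \<nu> \<in> gpaths_len G 2 \<and> color_order d \<nu> = [d y, d x] \<and>
          ((tail G x, [x, y], head G y), \<nu>) \<in> R"
        using k[unfolded KG2_def, rule_format, of "(tail G x, [x, y], head G y)" i j] xy
        by (simp add: awalk_simps)
    qed
  next
    assume a: "\<forall>x \<in> arcs G. \<forall>y \<in> arcs G. head G x = tail G y \<longrightarrow>
      (\<exists>!\<nu>. \<nu> \<in> gpaths_len G 2 \<and> color_order d \<nu> = [d y, d x] \<and>
        ((tail G x, [x, y], head G y), \<nu>) \<in> R)"
    show "KG2 G d R"
      unfolding KG2_def
    proof (intro ballI allI impI)
      fix \<mu> i j
      assume \<mu>: "\<mu> \<in> gpaths_len G 2" "color_order d \<mu> = [axis i 1, axis j 1]"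
      obtain u p v where "\<mu> = (u, p, v)" by (cases \<mu>)
      with \<mu> obtain x y where xy: "\<mu> = (tail G x, [x, y], head G y)" "x \<in> arcs G" "y \<in> arcs G"
          "head G x = tail G y" and c: "axis i 1 = d x" "axis j 1 = d y"
        by (auto simp: awalk_simps)
      show "\<exists>!\<nu>. \<nu> \<in> gpaths_len G 2 \<and> color_order d \<nu> = [axis j 1, axis i 1] \<and> (\<mu>, \<nu>) \<in> R"
        unfolding c xy(1) using a xy(2-4) by blast
    qed
  qed
  also have "\<dots> \<longleftrightarrow> (\<forall>x \<in> arcs G. \<forall>y \<in> arcs G. head G x = tail G y \<longrightarrow> (\<exists>!e. swap x y (fst e) (snd e)))"
    by (simp only: eq)
  also have "\<dots> \<longleftrightarrow> has_squares \<and>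
    (\<forall>x y x1 y1 x2 y2. swap x y x1 y1 \<longrightarrow> swap x y x2 y2 \<longrightarrow> x1 = x2 \<and> y1 = y2)"
    (is "?L \<longleftrightarrow> ?R")
  proof
    assume L: ?L
    then have has_squares unfolding has_squares_def by blast
    moreover have "x1 = x2 \<and> y1 = y2" if s: "swap x y x1 y1" "swap x y x2 y2" for x y x1 y1 x2 y2
    proof -
      have "\<exists>!e. swap x y (fst e) (snd e)" using L swap_D(1-3)[OF s(1)] by blast
      then have "(x1, y1) = (x2, y2)" using s by (metis fst_conv snd_conv)
      then show ?thesis by simp
    qed
    ultimately show ?R by blast
  next
    assume R: ?R
    show ?L
    proof (intro ballI impI)
      fix x y
      assume "x \<in> arcs G" "y \<in> arcs G" "head G x = tail G y"
      with R obtain x' y' where s: "swap x y x' y'" unfolding has_squares_def by blast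
      show "\<exists>!e. swap x y (fst e) (snd e)"
      proof (rule ex1I[of _ "(x', y')"])
        show "e = (x', y')" if "swap x y (fst e) (snd e)" for e
          using R s that by (metis prod.collapse)
      qed (use s in simp)
    qed
  qed
  finally show ?thesis .
qed

end

section \<open>Sorting the edges of a path by color\<close>

text \<open>A congruence that satisfies the three conditions on short paths.\<close>

locale commuting_squares = path_congruence G d R
  for G :: "('v, 'e) pre_digraph" and d :: "'e \<Rightarrow> nat ^ 'k::finite" and R :: "('v, 'e) path rel" +
  assumes KG1: "KG1 G R" and KG2: "KG2 G d R" and KG3: "KG3 G d R"
begin

lemma squares: has_squares
  using KG2 unfolding KG2_iff by blast

lemma swap_unique: "swap x y x1 y1 \<Longrightarrow> swap x y x2 y2 \<Longrightarrow> x1 = x2 \<and> y1 = y2"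
  using KG2 unfolding KG2_iff by blast

lemma swap_exists:
  assumes "x \<in> arcs G" "y \<in> arcs G" "head G x = tail G y"
  obtains x' y' where "swap x y x' y'"
  using squares assms that unfolding has_squares_def by blast

text \<open>\<open>KG3\<close> in the order of traversal: the two ways of reversing the color order of the path that
  traverses \<open>x\<close>, \<open>y\<close>, \<open>z\<close> end in the same path.\<close>

lemma hexagon:
  assumes l: "swap x y x1 y1" "swap y1 z y2 z1" "swap x1 y2 x2 y3"
    and r: "swap y z y1' z1'" "swap x y1' x2' y2'" "swap y2' z1' y3' z2'"
    and dist: "distinct [d x, d y, d z]"
  shows "x2 = x2' \<and> y3 = y3' \<and> z1 = z2'"
proof -
  note D = swap_D[OF l(1)] swap_D[OF l(2)] swap_D[OF l(3)]
    swap_D[OF r(1)] swap_D[OF r(2)] swap_D[OF r(3)]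
  have "swap2 G d R z y z1' y1'" "swap2 G d R y1' x y2' x2'" "swap2 G d R z1' y2' z2' y3'"
    "swap2 G d R y x y1 x1" "swap2 G d R z y1 z1 y2" "swap2 G d R y2 x1 y3 x2"
    using D l r by (simp_all add: swap2_iff_swap)
  moreover have "{z, y, x} \<subseteq> arcs G \<and> tail G z = head G y \<and> tail G y = head G x \<and>
      distinct [d z, d y, d x]"
    using D dist by auto
  ultimately have "epath G z2' \<cdot> epath G y3' \<cdot> epath G x2' = epath G z1 \<cdot> epath G y3 \<cdot> epath G x2"
    using KG3[unfolded KG3_def, rule_format, of z y x z1' y1' y2' x2' z2' y3' y1 x1 z1 y2 y3 x2]
    by simp
  then show ?thesis by (simp add: epath_def)
qed

text \<open>The position of the color of an edge in an arbitrary linear order on the colors, which comes from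
  an injection of the colors into the natural numbers.\<close>

definition rank :: "'e \<Rightarrow> nat" where
  "rank x = to_nat (d x)"

text \<open>A sorting step replaces two consecutive edges whose colors are in the wrong order by the
  equivalent pair with the colors interchanged.\<close>

inductive sort_step :: "'e list \<Rightarrow> 'e list \<Rightarrow> bool" where
  here: "swap x y x' y' \<Longrightarrow> rank y < rank x \<Longrightarrow> sort_step (x # y # p) (x' # y' # p)"
| there: "sort_step p q \<Longrightarrow> sort_step (x # p) (x # q)"

text \<open>Two edge lists are joinable if they can be sorted, possibly only in part, to a common list.\<close>

definition joinable :: "'e list \<Rightarrow> 'e list \<Rightarrow> bool" where
  "joinable p q \<longleftrightarrow> (\<exists>s. sort_step\<^sup>*\<^sup>* p s \<and> sort_step\<^sup>*\<^sup>* q s)"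

lemma joinable_refl: "joinable p p"
  unfolding joinable_def by blast

lemma joinable_sym: "joinable p q \<Longrightarrow> joinable q p"
  unfolding joinable_def by blast

lemma steps_joinable: "sort_step\<^sup>*\<^sup>* p q \<Longrightarrow> joinable p q"
  unfolding joinable_def by blast

lemma steps_Cons: "sort_step\<^sup>*\<^sup>* p q \<Longrightarrow> sort_step\<^sup>*\<^sup>* (x # p) (x # q)"
  by (induction rule: rtranclp_induct) (auto intro: sort_step.there rtranclp.rtrancl_into_rtrancl)

lemma steps_append_left: "sort_step\<^sup>*\<^sup>* p q \<Longrightarrow> sort_step\<^sup>*\<^sup>* (r @ p) (r @ q)"
  by (induction r) (auto intro: steps_Cons)

lemma step_append_right: "sort_step p q \<Longrightarrow> sort_step (p @ r) (q @ r)"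
  by (induction rule: sort_step.induct) (auto intro: sort_step.intros)

lemma steps_append_right: "sort_step\<^sup>*\<^sup>* p q \<Longrightarrow> sort_step\<^sup>*\<^sup>* (p @ r) (q @ r)"
  by (induction rule: rtranclp_induct)
    (auto intro: step_append_right rtranclp.rtrancl_into_rtrancl)

lemma joinable_append: "joinable p p' \<Longrightarrow> joinable q q' \<Longrightarrow> joinable (p @ q) (p' @ q')"
proof -
  assume "joinable p p'" "joinable q q'"
  then obtain s t where s: "sort_step\<^sup>*\<^sup>* p s" "sort_step\<^sup>*\<^sup>* p' s"
    and t: "sort_step\<^sup>*\<^sup>* q t" "sort_step\<^sup>*\<^sup>* q' t"
    unfolding joinable_def by blast
  have "sort_step\<^sup>*\<^sup>* (p @ q) (s @ t)" "sort_step\<^sup>*\<^sup>* (p' @ q') (s @ t)"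
    using s t steps_append_left steps_append_right by (blast intro: rtranclp_trans)+
  then show ?thesis unfolding joinable_def by blast
qed

lemma step_awalk: "sort_step p q \<Longrightarrow> awalk u p v \<longleftrightarrow> awalk u q v"
proof (induction arbitrary: u rule: sort_step.induct)
  case (here x y x' y' p)
  from swap_D[OF here(1)] show ?case by (auto simp: awalk_Cons_iff)
next
  case (there p q x)
  then show ?case by (simp add: awalk_Cons_iff)
qed

lemma step_mset: "sort_step p q \<Longrightarrow> mset (map d q) = mset (map d p)"
proof (induction rule: sort_step.induct)
  case (here x y x' y' p)
  from swap_D(9,10)[OF here(1)] show ?case by simp
qed simp

lemma steps_awalk_mset:
  "sort_step\<^sup>*\<^sup>* p q \<Longrightarrow> (awalk u p v \<longleftrightarrow> awalk u q v) \<and> mset (map d q) = mset (map d p)"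
  by (induction rule: rtranclp_induct) (simp_all add: step_awalk step_mset del: mset_map)

text \<open>The first color that a step changes becomes smaller, so the color order decreases
  lexicographically.\<close>

lemma step_decreases: "sort_step p q \<Longrightarrow> (map rank q, map rank p) \<in> lex less_than"
  by (induction rule: sort_step.induct) (auto dest: swap_D(9) simp: rank_def)

lemma wfp_step: "wfp (\<lambda>q p. sort_step p q)"
  unfolding wfp_def
  by (rule wf_subset[OF wf_inv_image[OF wf_lex[OF wf_less_than], of "map rank"]])
    (auto dest: step_decreases)

text \<open>If two steps overlap in three consecutive edges, then these have colors of decreasing rank, and
  both ways of reversing them agree by \<open>hexagon\<close>.\<close>

lemma overlap_joinable:
  assumes xy: "swap x y x1 y1" "rank y < rank x" and yz: "swap y z y1' z1'" "rank z < rank y"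
  shows "joinable (x1 # y1 # z # p) (x # y1' # z1' # p)"
proof -
  note D = swap_D[OF xy(1)] swap_D[OF yz(1)]
  obtain y2 z1 where l2: "swap y1 z y2 z1"
    using D by (metis swap_exists)
  obtain x2 y3 where l3: "swap x1 y2 x2 y3"
    using D swap_D[OF l2] by (metis swap_exists)
  obtain x2' y2' where r2: "swap x y1' x2' y2'"
    using D by (metis swap_exists)
  obtain y3' z2' where r3: "swap y2' z1' y3' z2'"
    using D swap_D[OF r2] by (metis swap_exists)
  have "distinct [d x, d y, d z]"
    using xy(2) yz(2) by (auto simp: rank_def)
  from hexagon[OF xy(1) l2 l3 yz(1) r2 r3 this]
  have eq: "x2 = x2'" "y3 = y3'" "z1 = z2'" by auto
  note E = D swap_D[OF l2] swap_D[OF l3] swap_D[OF r2] swap_D[OF r3]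
  have r: "rank y1 = rank x" "rank x1 = rank y" "rank y2 = rank z"
    "rank y1' = rank z" "rank z1' = rank y" "rank y2' = rank x"
    using E by (simp_all add: rank_def)
  have "sort_step (x1 # y1 # z # p) (x1 # y2 # z1 # p)" "sort_step (x1 # y2 # z1 # p) (x2 # y3 # z1 # p)"
    using l2 l3 r xy(2) yz(2) by (auto intro!: sort_step.intros)
  moreover have "sort_step (x # y1' # z1' # p) (x2' # y2' # z1' # p)"
    "sort_step (x2' # y2' # z1' # p) (x2' # y3' # z2' # p)"
    using r2 r3 r xy(2) yz(2) by (auto intro!: sort_step.intros)
  ultimately show ?thesis
    unfolding joinable_def eq by (meson rtranclp.rtrancl_refl converse_rtranclp_into_rtranclp)
qed

lemma here_joinable:
  assumes xy: "swap x y x' y'" "rank y < rank x" and "sort_step (x # y # p) r"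
  shows "joinable (x' # y' # p) r"
  using assms(3)
proof (cases rule: sort_step.cases)
  case (here x'' y'')
  with swap_unique[OF xy(1)] show ?thesis by (auto intro: joinable_refl)
next
  case (there q)
  from there(2) show ?thesis
  proof (cases rule: sort_step.cases)
    case (here z y'' z'' p')
    with overlap_joinable xy there(1) show ?thesis by auto
  next
    case (there p')
    then have "sort_step (x' # y' # p) (x' # y' # p')" "sort_step r (x' # y' # p')"
      using xy \<open>r = x # q\<close> by (auto intro: sort_step.intros)
    then show ?thesis unfolding joinable_def by blast
  qed
qed

lemma local_confluence: "sort_step p q \<Longrightarrow> sort_step p r \<Longrightarrow> joinable q r"
proof (induction arbitrary: r rule: sort_step.induct)
  case (here x y x' y' p)
  then show ?case by (rule here_joinable)
next
  case (there p q x)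
  from there.prems show ?case
  proof (cases rule: sort_step.cases)
    case (here y x' y' p')
    moreover have "sort_step (x # y # p') (x # q)"
      using there.hyps here by (auto intro: sort_step.there)
    ultimately show ?thesis using here_joinable joinable_sym by blast
  next
    case (there r')
    with \<open>\<And>r. sort_step p r \<Longrightarrow> joinable q r\<close> show ?thesis
      unfolding joinable_def by (meson steps_Cons)
  qed
qed

text \<open>Newman's lemma.\<close>

lemma confluence: "sort_step\<^sup>*\<^sup>* p q \<Longrightarrow> sort_step\<^sup>*\<^sup>* p r \<Longrightarrow> joinable q r"
proof (induction p arbitrary: q r rule: wfp_induct_rule[OF wfp_step])
  case (1 p)
  show ?case
  proof (cases "p = q \<or> p = r")
    case True
    with 1(2,3) show ?thesis by (auto intro: steps_joinable joinable_sym)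
  next
    case False
    with 1(2,3) obtain q1 r1 where q1: "sort_step p q1" "sort_step\<^sup>*\<^sup>* q1 q"
      and r1: "sort_step p r1" "sort_step\<^sup>*\<^sup>* r1 r"
      by (metis converse_rtranclpE)
    obtain s where s: "sort_step\<^sup>*\<^sup>* q1 s" "sort_step\<^sup>*\<^sup>* r1 s"
      using local_confluence[OF q1(1) r1(1)] unfolding joinable_def by blast
    obtain t where t: "sort_step\<^sup>*\<^sup>* q t" "sort_step\<^sup>*\<^sup>* s t"
      using 1(1)[OF q1 s(1)] unfolding joinable_def by blast
    have "sort_step\<^sup>*\<^sup>* r1 t" using s(2) t(2) by (rule rtranclp_trans)
    with 1(1)[OF r1(1) _ r1(2)] obtain w where "sort_step\<^sup>*\<^sup>* t w" "sort_step\<^sup>*\<^sup>* r w"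
      unfolding joinable_def by blast
    with t(1) show ?thesis unfolding joinable_def by (meson rtranclp_trans)
  qed
qed

lemma joinable_trans: "joinable p q \<Longrightarrow> joinable q r \<Longrightarrow> joinable p r"
proof -
  assume "joinable p q" "joinable q r"
  then obtain s t where s: "sort_step\<^sup>*\<^sup>* p s" "sort_step\<^sup>*\<^sup>* q s"
    and t: "sort_step\<^sup>*\<^sup>* q t" "sort_step\<^sup>*\<^sup>* r t"
    unfolding joinable_def by blast
  obtain w where w: "sort_step\<^sup>*\<^sup>* s w" "sort_step\<^sup>*\<^sup>* t w"
    using confluence[OF s(2) t(1)] unfolding joinable_def by blast
  show ?thesis
    unfolding joinable_def using rtranclp_trans[OF s(1) w(1)] rtranclp_trans[OF t(2) w(2)] by blast
qed

text \<open>Where a step applies depends only on the colors, and it can be undone because \<open>swap\<close> is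
  symmetric.\<close>

lemma step_parallel:
  "sort_step p q \<Longrightarrow> map d p' = map d p \<Longrightarrow> awalk u p' v \<Longrightarrow>
    \<exists>q'. sort_step p' q' \<and> map d q' = map d q \<and> (q' = q \<longrightarrow> p' = p)"
proof (induction arbitrary: p' u rule: sort_step.induct)
  case (here x y x1 y1 p)
  then obtain x' y' r where p': "p' = x' # y' # r" "d x' = d x" "d y' = d y" "map d r = map d p"
    by (auto simp: map_eq_Cons_conv)
  with here(4) have "x' \<in> arcs G" "y' \<in> arcs G" "head G x' = tail G y'"
    by (auto simp: awalk_Cons_iff)
  then obtain x1' y1' where s: "swap x' y' x1' y1'" by (rule swap_exists)
  have "sort_step p' (x1' # y1' # r)"
    unfolding p'(1) using s here(2) p' by (intro sort_step.here) (simp_all add: rank_def)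
  moreover have "map d (x1' # y1' # r) = map d (x1 # y1 # p)"
    using swap_D(9,10)[OF s] swap_D(9,10)[OF here(1)] p' by simp
  moreover have "p' = x # y # p" if "x1' # y1' # r = x1 # y1 # p"
    using that swap_unique[OF swap_sym[OF s]] swap_sym[OF here(1)] p'(1) by auto
  ultimately show ?case by blast
next
  case (there p q x)
  then obtain x' r where p': "p' = x' # r" "d x' = d x" "map d r = map d p"
    by (auto simp: map_eq_Cons_conv)
  with there.prems(2) have "awalk (head G x') r v"
    by (simp add: awalk_Cons_iff)
  from there.IH[OF p'(3) this] obtain q' where
    "sort_step r q'" "map d q' = map d q" "q' = q \<longrightarrow> r = p" by blast
  with p' show ?case by (intro exI[of _ "x' # q'"]) (auto intro: sort_step.there)
qed

text \<open>By induction along the sorting of \<open>p\<close>: the same steps apply to \<open>p'\<close>, they lead to the same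
  sorted path, and each of them can be undone.\<close>

lemma joinable_same_colors_imp_eq:
  "joinable p p' \<Longrightarrow> map d p' = map d p \<Longrightarrow> awalk u p v \<Longrightarrow> awalk u p' v \<Longrightarrow> p' = p"
proof (induction p arbitrary: p' rule: wfp_induct_rule[OF wfp_step])
  case (1 p)
  show ?case
  proof (cases "\<exists>q. sort_step p q")
    case True
    then obtain q where q: "sort_step p q" ..
    with step_parallel[OF q 1(3,5)] obtain q' where
      q': "sort_step p' q'" "map d q' = map d q" "q' = q \<longrightarrow> p' = p" by blast
    have "joinable q p" "joinable p' q'"
      using q q'(1) by (auto intro: steps_joinable joinable_sym)
    then have "joinable q q'" using 1(2) joinable_trans by blast
    with 1(1)[OF q] q q' 1(4,5) show ?thesis using step_awalk by blast
  next
    case False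
    then have "\<nexists>q. sort_step p' q"
      using step_parallel[OF _ 1(3)[symmetric] 1(4)] by blast
    with False 1(2) show ?thesis
      unfolding joinable_def by (metis converse_rtranclpE)
  qed
qed

text \<open>The relation on paths of having the same endpoints and joinable edge lists.\<close>

definition join_rel :: "('v, 'e) path rel" where
  "join_rel = {((u, p, v), (u', q, v')). u' = u \<and> v' = v \<and> awalk u p v \<and> awalk u q v \<and> joinable p q}"

lemma joinable_mset: "joinable p q \<Longrightarrow> mset (map d p) = mset (map d q)"
  unfolding joinable_def using steps_awalk_mset[THEN conjunct2] by metis

lemma join_rel_congruence:
  "equiv (gpaths G) join_rel" "rsd_preserving d join_rel" "KG0 G join_rel"
proof -
  show eq: "equiv (gpaths G) join_rel"
  proof (rule equivI)
    show "join_rel \<subseteq> gpaths G \<times> gpaths G" by (auto simp: join_rel_def)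
    show "refl_on (gpaths G) join_rel"
      by (auto simp: refl_on_def join_rel_def gpaths_def joinable_refl)
    show "sym join_rel" by (auto simp: sym_def join_rel_def joinable_sym)
    show "trans join_rel" by (auto simp: trans_def join_rel_def intro: joinable_trans)
  qed
  show "rsd_preserving d join_rel"
    unfolding rsd_preserving_def join_rel_def
    using joinable_mset by (auto simp flip: sum_mset_sum_list simp del: mset_map)
  show "KG0 G join_rel"
  proof (rule KG0I[OF eq])
    fix \<kappa>\<^sub>1 \<kappa>\<^sub>2 p\<^sub>1 p\<^sub>2
    assume "(\<kappa>\<^sub>1, p\<^sub>1) \<in> join_rel" "(\<kappa>\<^sub>2, p\<^sub>2) \<in> join_rel" "psrc \<kappa>\<^sub>2 = prng \<kappa>\<^sub>1"
    then show "(\<kappa>\<^sub>2 \<cdot> \<kappa>\<^sub>1, p\<^sub>2 \<cdot> p\<^sub>1) \<in> join_rel"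
      by (cases \<kappa>\<^sub>1; cases \<kappa>\<^sub>2)
        (auto simp: join_rel_def awalk_append_ex intro: joinable_append simp del: awalk_append_iff)
  qed
qed

text \<open>For two edges, equality of the color multisets leaves two cases: two different colors are
  interchanged, and one path is obtained from the other by a step, or the color orders agree, and
  the paths are equal by \<open>KG2\<close>.\<close>

lemma R_short_imp_joinable:
  assumes R: "((u, p, v), (u, q, v)) \<in> R" and len: "length p \<le> 2"
  shows "joinable p q"
proof -
  consider "length p = 0" | "length p = 1" | "length p = 2" using len by linarith
  then show ?thesis
  proof cases
    case 1
    with R_length[OF R] show ?thesis by (auto intro: joinable_refl)
  next
    case 2
    with KG1 R have "p = q" unfolding KG1_iff by blast
    then show ?thesis by (simp add: joinable_refl)
  next
    case 3
    with R_length[OF R] obtain x y x' y' where pq: "p = [x, y]" "q = [x', y']"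
      by (auto simp: length_Suc_conv numeral_2_eq_2)
    with R_D(1,2)[OF R] have xy: "x \<in> arcs G" "y \<in> arcs G" "head G x = tail G y"
      "u = tail G x" "v = head G y" "u = tail G x'" "v = head G y'"
      by (simp_all add: awalk_simps)
    have "{#d x, d y#} = {#d x', d y'#}" using R_D(5)[OF R] pq by simp
    then consider "d x' = d y" "d y' = d x" | "d x' = d x" "d y' = d y"
      by (auto simp: add_eq_conv_ex)
    then show ?thesis
    proof cases
      case 1
      with R pq xy have s: "swap x y x' y'" by (simp add: swap_def)
      consider "rank y < rank x" | "rank x < rank y" | "rank x = rank y" by linarith
      then show ?thesis
      proof cases
        case 1
        with s show ?thesis unfolding pq by (auto intro!: steps_joinable sort_step.here)
      next
        case 2
        with swap_sym[OF s] swap_D(9,10)[OF s] show ?thesis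
          unfolding pq by (auto intro!: joinable_sym[OF steps_joinable] sort_step.here simp: rank_def)
      next
        case 3
        then have "d x = d y" by (simp add: rank_def)
        moreover have "((u, [x, y], v), (u, [x, y], v)) \<in> R" using R_D(1)[OF R] R_refl pq by simp
        ultimately have "swap x y x y" using xy by (simp add: swap_def)
        from swap_unique[OF this s] show ?thesis unfolding pq by (auto intro: joinable_refl)
      qed
    next
      case 2
      \<comment> \<open>Both paths arise from \<open>[x1, y1]\<close> by interchanging the colors, so they are equal.\<close>
      obtain x1 y1 where s: "swap x y x1 y1" using swap_exists[OF xy(1-3)] .
      have "((u, [x', y'], v), (u, [x1, y1], v)) \<in> R"
        using R_trans[OF R_sym[OF R], of "(u, [x1, y1], v)"] s pq xy(4,5) by (simp add: swap_def)
      with 2 s xy have "swap x' y' x1 y1" unfolding swap_def by metis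
      from swap_unique[OF swap_sym[OF s] swap_sym[OF this]] show ?thesis
        unfolding pq by (auto intro: joinable_refl)
    qed
  qed
qed

lemma generated_imp_KG4:
  assumes gen: "generated_by_squares G d R"
  shows "KG4 G d R"
proof -
  have "R \<subseteq> join_rel"
  proof -
    have "\<mu> \<in> join_rel `` {\<kappa>}" if "(\<kappa>, \<mu>) \<in> R" "length (pedges \<kappa>) \<le> 2" for \<kappa> \<mu>
    proof -
      obtain u p v u' q v' where [simp]: "\<kappa> = (u, p, v)" "\<mu> = (u', q, v')"
        by (cases \<kappa>; cases \<mu>)
      from R_D[of u p v u' q v'] R_short_imp_joinable[of u p v q] that
      show ?thesis by (auto simp: join_rel_def)
    qed
    then show ?thesis
      using gen join_rel_congruence unfolding generated_by_squares_def by blast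
  qed
  then have "q = q'" if "((u, p, v), (u, q, v)) \<in> R" "((u, p, v), (u, q', v)) \<in> R"
    "map d q = map d q'" for u p q q' v
  proof -
    have "((u, q, v), (u, q', v)) \<in> join_rel" using that R_sym R_trans \<open>R \<subseteq> join_rel\<close> by blast
    then show ?thesis using joinable_same_colors_imp_eq[of q' q u v] that(3)
      by (auto simp: join_rel_def joinable_sym)
  qed
  then show ?thesis
    unfolding KG4_iff using reorder[OF squares] by metis
qed

end

section \<open>Consequences of unique reordering\<close>

text \<open>A congruence for which every class has exactly one member with each permuted color order.\<close>

locale reorderable = path_congruence G d R
  for G :: "('v, 'e) pre_digraph" and d :: "'e \<Rightarrow> nat ^ 'k::finite" and R :: "('v, 'e) path rel" +
  assumes KG4: "KG4 G d R"
begin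

lemma reordering_exists:
  assumes "awalk u p v" "mset l = mset (map d p)"
  obtains q where "((u, p, v), (u, q, v)) \<in> R" "map d q = l"
  using KG4 assms that unfolding KG4_iff by blast

lemma same_colors_imp_eq:
  assumes R: "((u, p, v), (u, q, v)) \<in> R" and "map d q = map d p"
  shows "q = p"
  using KG4[unfolded KG4_iff, rule_format, OF R_D(1)[OF R] refl] R_refl[OF R_D(1)[OF R]] assms
  by blast

lemma KG1_holds: "KG1 G R"
  unfolding KG1_iff
proof (intro allI impI)
  fix u p q v
  assume R: "((u, p, v), (u, q, v)) \<in> R" and "length p = 1"
  with R_length[OF R] obtain f g where "p = [f]" "q = [g]"
    by (auto simp: length_Suc_conv)
  with R_D(5)[OF R] have "map d q = map d p" by simp
  then show "p = q" using same_colors_imp_eq[OF R] by simp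
qed

lemma squares: has_squares
  unfolding has_squares_def
proof (intro ballI impI)
  fix x y
  assume "x \<in> arcs G" "y \<in> arcs G" "head G x = tail G y"
  then have "awalk (tail G x) [x, y] (head G y)" by (simp add: awalk_simps)
  then obtain q where q: "((tail G x, [x, y], head G y), (tail G x, q, head G y)) \<in> R"
    "map d q = [d y, d x]"
    by (rule reordering_exists[where l = "[d y, d x]"]) auto
  from q(2) obtain x' y' where "q = [x', y']" "d x' = d y" "d y' = d x"
    by (auto simp: map_eq_Cons_conv)
  with q(1) have "swap x y x' y'" by (simp add: swap_def)
  then show "\<exists>x' y'. swap x y x' y'" by blast
qed

lemma KG2_holds: "KG2 G d R"
  unfolding KG2_iff
proof (intro conjI squares allI impI)
  fix x y x1 y1 x2 y2
  assume s: "swap x y x1 y1" "swap x y x2 y2"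
  have "((tail G x, [x1, y1], head G y), (tail G x, [x2, y2], head G y)) \<in> R"
    by (rule R_trans[OF R_sym[of "(tail G x, [x, y], head G y)"]])
      (use s in \<open>simp_all add: swap_def\<close>)
  from same_colors_imp_eq[OF this] swap_D(9,10)[OF s(1)] swap_D(9,10)[OF s(2)]
  show "x1 = x2" "y1 = y2" by simp_all
qed

lemma swap_first_two:
  assumes s: "swap x y x' y'" and z: "z \<in> arcs G" "head G y = tail G z"
  shows "((tail G x, [x, y, z], head G z), (tail G x, [x', y', z], head G z)) \<in> R"
proof -
  have "((head G y, [z], head G z), (head G y, [z], head G z)) \<in> R"
    using z by (intro R_refl) (simp add: awalk_simps)
  from R_append[OF _ this, of "tail G x" "[x, y]" "[x', y']"] s show ?thesis
    by (simp add: swap_def)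
qed

lemma swap_last_two:
  assumes s: "swap x y x' y'" and z: "z \<in> arcs G" "head G z = tail G x"
  shows "((tail G z, [z, x, y], head G y), (tail G z, [z, x', y'], head G y)) \<in> R"
proof -
  have "((tail G z, [z], tail G x), (tail G z, [z], tail G x)) \<in> R"
    using z head_in_verts[OF z(1)] by (intro R_refl) (simp add: awalk_simps)
  from R_append[OF this, of "[x, y]" "head G y" "[x', y']"] s show ?thesis
    by (simp add: swap_def)
qed

lemma KG3_holds: "KG3 G d R"
  unfolding KG3_def
proof (intro allI impI, elim conjE)
  fix a b c d' e f g h j k m n p r q
  assume abc: "{a, b, c} \<subseteq> arcs G" "tail G a = head G b" "tail G b = head G c"
    and "swap2 G d R a b d' e" "swap2 G d R e c f g" "swap2 G d R d' f h j"
    and "swap2 G d R b c k m" "swap2 G d R a k n p" "swap2 G d R p m r q"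
  note s2 = this(4-9)
  have s1: "swap b a e d'" using s2(1) abc by (simp add: swap2_iff_swap)
  note D1 = swap_D[OF s1]
  have t1: "swap c e g f" using s2(2) abc D1 by (simp add: swap2_iff_swap)
  note D2 = swap_D[OF t1]
  have u1: "swap f d' j h" using s2(3) D1 D2 by (simp add: swap2_iff_swap)
  note D3 = swap_D[OF u1]
  have r1: "swap c b m k" using s2(4) abc by (simp add: swap2_iff_swap)
  note E1 = swap_D[OF r1]
  have r2: "swap k a p n" using s2(5) abc E1 by (simp add: swap2_iff_swap)
  note E2 = swap_D[OF r2]
  have r3: "swap m p q r" using s2(6) E1 E2 by (simp add: swap2_iff_swap)
  note E3 = swap_D[OF r3]
  have "((tail G c, [c, b, a], head G a), (tail G c, [c, e, d'], head G a)) \<in> R"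
    using swap_last_two[OF s1, of c] abc by simp
  moreover have "((tail G c, [c, e, d'], head G a), (tail G c, [g, f, d'], head G a)) \<in> R"
    using swap_first_two[OF t1, of d'] D1 by simp
  moreover have "((tail G c, [g, f, d'], head G a), (tail G c, [g, j, h], head G a)) \<in> R"
    using swap_last_two[OF u1, of g] D1 D2 by simp
  ultimately have left: "((tail G c, [c, b, a], head G a), (tail G c, [g, j, h], head G a)) \<in> R"
    using R_trans by blast
  have "((tail G c, [c, b, a], head G a), (tail G c, [m, k, a], head G a)) \<in> R"
    using swap_first_two[OF r1, of a] abc by simp
  moreover have "((tail G c, [m, k, a], head G a), (tail G c, [m, p, n], head G a)) \<in> R"
    using swap_last_two[OF r2, of m] E1 by simp
  moreover have "((tail G c, [m, p, n], head G a), (tail G c, [q, r, n], head G a)) \<in> R"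
    using swap_first_two[OF r3, of n] E1 E2 by simp
  ultimately have "((tail G c, [c, b, a], head G a), (tail G c, [q, r, n], head G a)) \<in> R"
    using R_trans by blast
  from R_trans[OF R_sym[OF left] this] have "[q, r, n] = [g, j, h]"
    by (rule same_colors_imp_eq) (simp add: D1 D2 D3 E1 E2 E3)
  then show "epath G h \<cdot> epath G j \<cdot> epath G g = epath G n \<cdot> epath G r \<cdot> epath G q" by simp
qed

text \<open>A congruence \<open>S\<close> that contains the identifications of short paths contains the squares, so
  that \<open>reorder\<close> applies to \<open>R \<inter> S\<close>. The reordering that it produces is the only one for \<open>R\<close>.\<close>

lemma generated_by_squares_holds: "generated_by_squares G d R"
  unfolding generated_by_squares_def
proof (intro allI impI, elim conjE)
  fix S
  assume S: "equiv (gpaths G) S" "rsd_preserving d S" "KG0 G S"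
    and short: "\<forall>(\<kappa>, \<mu>) \<in> R. length (pedges \<kappa>) \<le> 2 \<longrightarrow> (\<kappa>, \<mu>) \<in> S"
  interpret S: path_congruence G d S
    by unfold_locales (fact S)+
  have eq: "equiv (gpaths G) (R \<inter> S)"
    using equiv S(1) unfolding equiv_def by (auto simp: refl_on_def sym_Int trans_Int)
  have comp: "(\<kappa>\<^sub>2 \<cdot> \<kappa>\<^sub>1, p\<^sub>2 \<cdot> p\<^sub>1) \<in> R \<inter> S"
    if "(\<kappa>\<^sub>1, p\<^sub>1) \<in> R \<inter> S" "(\<kappa>\<^sub>2, p\<^sub>2) \<in> R \<inter> S" "psrc \<kappa>\<^sub>2 = prng \<kappa>\<^sub>1" for \<kappa>\<^sub>1 \<kappa>\<^sub>2 p\<^sub>1 p\<^sub>2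
  proof -
    obtain u p v where 1: "\<kappa>\<^sub>1 = (u, p, v)" by (cases \<kappa>\<^sub>1)
    obtain u1 p' v1 where 2: "p\<^sub>1 = (u1, p', v1)" by (cases p\<^sub>1)
    obtain v2 q w where 3: "\<kappa>\<^sub>2 = (v2, q, w)" by (cases \<kappa>\<^sub>2)
    obtain v3 q' w1 where 4: "p\<^sub>2 = (v3, q', w1)" by (cases p\<^sub>2)
    have "u1 = u" "v1 = v" using that(1) R_D(3,4)[of u p v u1 p' v1] 1 2 by auto
    moreover have "v3 = v2" "w1 = w" using that(2) R_D(3,4)[of v2 q w v3 q' w1] 3 4 by auto
    moreover have "v2 = v" using that(3) 1 3 by simp
    ultimately show ?thesis
      using that(1,2) 1 2 3 4 R_append[of u p v p' q w q'] S.R_append[of u p v p' q w q'] by simp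
  qed
  interpret RS: path_congruence G d "R \<inter> S"
    using eq KG0I[OF eq comp] rsd by unfold_locales (auto simp: rsd_preserving_def)
  have sq: RS.has_squares
    unfolding RS.has_squares_def
  proof (intro ballI impI)
    fix x y
    assume "x \<in> arcs G" "y \<in> arcs G" "head G x = tail G y"
    then obtain x' y' where "swap x y x' y'" using squares unfolding has_squares_def by blast
    then have "RS.swap x y x' y'" using short unfolding swap_def RS.swap_def by auto
    then show "\<exists>x' y'. RS.swap x y x' y'" by blast
  qed
  show "R \<subseteq> S"
  proof (rule subrelI)
    fix \<kappa> \<mu>
    assume R: "(\<kappa>, \<mu>) \<in> R"
    obtain u p v u' q v' where \<kappa>: "\<kappa> = (u, p, v)" "\<mu> = (u', q, v')" by (cases \<kappa>; cases \<mu>)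
    note R = R[unfolded \<kappa>]
    note D = R_D[OF R]
    obtain q' where q': "((u, p, v), (u, q', v)) \<in> R \<inter> S" "map d q' = map d q"
      using RS.reorder[OF sq D(1) D(5)[symmetric]] by blast
    have "((u, q, v), (u, q', v)) \<in> R"
      using R_trans[OF R_sym[OF R]] q'(1) D(3,4) by simp
    from same_colors_imp_eq[OF this q'(2)] have "q' = q" .
    with q'(1) D(3,4) \<kappa> show "(\<kappa>, \<mu>) \<in> S" by simp
  qed
qed

end

section \<open>The quotient category\<close>

context path_congruence
begin

text \<open>The class of the path \<open>(u, p, v)\<close> as a morphism of the quotient.\<close>

definition cls :: "'v \<Rightarrow> 'e list \<Rightarrow> 'v \<Rightarrow> ('v, 'e) path set" where
  "cls u p v = R `` {(u, p, v)}"

lemma cls_eq_iff: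
  "awalk u p v \<Longrightarrow> awalk u' q v' \<Longrightarrow> cls u p v = cls u' q v' \<longleftrightarrow> ((u, p, v), (u', q, v')) \<in> R"
  unfolding cls_def by (intro eq_equiv_class_iff[OF equiv]) simp_all

lemma mem_cls:
  "x \<in> cls u p v \<longleftrightarrow> (\<exists>q. x = (u, q, v) \<and> ((u, p, v), (u, q, v)) \<in> R)"
  unfolding cls_def by (cases x) (auto dest: R_D(3,4))

lemma image_cls:
  assumes "awalk u p v" and "\<And>q. ((u, p, v), (u, q, v)) \<in> R \<Longrightarrow> f (u, q, v) = a"
  shows "the_elem (f ` cls u p v) = a"
proof -
  have "f ` cls u p v = {a}"
    using assms R_refl[OF assms(1)] by (force simp: mem_cls image_iff)
  then show ?thesis by simp
qed

lemma Obj_quotient: "Obj (path_quotient G R) = verts G"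
  by (simp add: path_quotient_def)

lemma Mor_quotient: "X \<in> Mor (path_quotient G R) \<longleftrightarrow> (\<exists>u p v. awalk u p v \<and> X = cls u p v)"
  by (auto simp: path_quotient_def quotient_def cls_def gpaths_def)

lemma Dom_quotient: "awalk u p v \<Longrightarrow> Dom (path_quotient G R) (cls u p v) = u"
  by (simp add: path_quotient_def image_cls)

lemma Cod_quotient: "awalk u p v \<Longrightarrow> Cod (path_quotient G R) (cls u p v) = v"
  by (simp add: path_quotient_def image_cls)

lemma Ident_quotient: "Ident (path_quotient G R) u = cls u [] u"
  by (simp add: path_quotient_def cls_def vpath_def)

lemma degree_quotient:
  assumes "awalk u p v"
  shows "quotient_degree d (cls u p v) = sum_list (map d p)"
  unfolding quotient_degree_def
proof (rule image_cls[OF assms])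
  fix q
  assume "((u, p, v), (u, q, v)) \<in> R"
  then show "pdegree d (u, q, v) = sum_list (map d p)"
    using rsd unfolding rsd_preserving_def by fastforce
qed

lemma Comp_quotient:
  assumes "awalk u p v" "awalk v q w"
  shows "Comp (path_quotient G R) (cls v q w) (cls u p v) = cls u (p @ q) w"
proof -
  have "R `` {x \<cdot> y} = cls u (p @ q) w" if xy: "x \<in> cls v q w" "y \<in> cls u p v" for x y
  proof -
    from xy obtain q' p' where "x = (v, q', w)" "((v, q, w), (v, q', w)) \<in> R"
      "y = (u, p', v)" "((u, p, v), (u, p', v)) \<in> R" unfolding mem_cls by blast
    then show ?thesis
      using equiv_class_eq[OF equiv R_append[of u p v p' q w q']] by (simp add: cls_def)
  qed
  moreover have "(v, q, w) \<in> cls v q w" "(u, p, v) \<in> cls u p v"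
    using assms by (simp_all add: mem_cls R_refl)
  ultimately have "(\<Union>x\<in>cls v q w. \<Union>y\<in>cls u p v. R `` {x \<cdot> y}) = cls u (p @ q) w"
    by blast
  then show ?thesis by (simp add: path_quotient_def)
qed

lemma awalk_appendI: "awalk u p v \<Longrightarrow> awalk v q w \<Longrightarrow> awalk u (p @ q) w"
  unfolding awalk_append_ex by blast

lemmas quotient_simps = Dom_quotient Cod_quotient Ident_quotient degree_quotient Comp_quotient
  awalk_appendI awalk_Nil_iff

lemma small_category_quotient: "small_category (path_quotient G R)"
proof
  fix X
  assume "X \<in> Mor (path_quotient G R)"
  then obtain u p v where X: "awalk u p v" "X = cls u p v" unfolding Mor_quotient by blast
  note uv = awalk_hd_in_verts[OF X(1)] awalk_last_in_verts[OF X(1)]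
  show "Dom (path_quotient G R) X \<in> Obj (path_quotient G R)"
    "Cod (path_quotient G R) X \<in> Obj (path_quotient G R)"
    using X uv by (simp_all add: Obj_quotient quotient_simps)
  show "Comp (path_quotient G R) X (Ident (path_quotient G R) (Dom (path_quotient G R) X)) = X"
    "Comp (path_quotient G R) (Ident (path_quotient G R) (Cod (path_quotient G R) X)) X = X"
    using X uv Comp_quotient[of u "[]" u p v] Comp_quotient[of u p v "[]" v]
    by (simp_all add: quotient_simps)
next
  fix v
  assume "v \<in> Obj (path_quotient G R)"
  then have v: "awalk v [] v" by (simp add: Obj_quotient awalk_Nil_iff)
  then show "Ident (path_quotient G R) v \<in> Mor (path_quotient G R)"
    unfolding Mor_quotient Ident_quotient by blast
  show "Dom (path_quotient G R) (Ident (path_quotient G R) v) = v"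
    "Cod (path_quotient G R) (Ident (path_quotient G R) v) = v"
    using v by (simp_all only: Ident_quotient Dom_quotient Cod_quotient)
next
  fix X Y
  assume "X \<in> Mor (path_quotient G R)" "Y \<in> Mor (path_quotient G R)"
    and eq: "Dom (path_quotient G R) X = Cod (path_quotient G R) Y"
  then obtain u p v v' q w where Y: "awalk u p v" "Y = cls u p v"
    and X: "awalk v' q w" "X = cls v' q w" unfolding Mor_quotient by blast
  with eq have "v' = v" by (simp add: quotient_simps)
  with X Y have XY: "Comp (path_quotient G R) X Y = cls u (p @ q) w" "awalk u (p @ q) w"
    by (simp_all only: Comp_quotient awalk_appendI)
  then show "Comp (path_quotient G R) X Y \<in> Mor (path_quotient G R)"
    unfolding Mor_quotient by blast
  show "Dom (path_quotient G R) (Comp (path_quotient G R) X Y) = Dom (path_quotient G R) Y"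
    "Cod (path_quotient G R) (Comp (path_quotient G R) X Y) = Cod (path_quotient G R) X"
    using X Y XY by (simp_all only: Dom_quotient Cod_quotient)
next
  fix X Y Z
  assume "X \<in> Mor (path_quotient G R)" "Y \<in> Mor (path_quotient G R)" "Z \<in> Mor (path_quotient G R)"
    and eq: "Dom (path_quotient G R) X = Cod (path_quotient G R) Y"
      "Dom (path_quotient G R) Y = Cod (path_quotient G R) Z"
  then obtain u p v v' q w w' r z where Z: "awalk u p v" "Z = cls u p v"
    and Y: "awalk v' q w" "Y = cls v' q w" and X: "awalk w' r z" "X = cls w' r z"
    unfolding Mor_quotient by blast
  with eq have "v' = v" "w' = w" by (simp_all add: quotient_simps)
  with X Y Z show "Comp (path_quotient G R) (Comp (path_quotient G R) X Y) Z =
      Comp (path_quotient G R) X (Comp (path_quotient G R) Y Z)"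
    by (simp only: Comp_quotient awalk_appendI append_assoc)
qed

lemma countable_gpaths:
  assumes "countable (verts G)" "countable (arcs G)"
  shows "countable (gpaths G)"
proof (rule countable_subset)
  show "gpaths G \<subseteq> verts G \<times> lists (arcs G) \<times> verts G"
    by (auto simp: gpaths_def intro: awalk_hd_in_verts awalk_last_in_verts)
  show "countable (verts G \<times> lists (arcs G) \<times> verts G)"
    using assms by (intro countable_SIGMA countable_lists)
qed

end

context reorderable
begin

text \<open>Every morphism of the quotient has a representative whose color order is any given list of basis
  vectors that sums up to its degree.\<close>

lemma representative:
  assumes X: "X \<in> Mor (path_quotient G R)" "quotient_degree d X = sum_list l"
    and l: "set l \<subseteq> range (\<lambda>i. axis i 1)"
  obtains u p v where "awalk u p v" "X = cls u p v" "map d p = l"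
proof -
  from X(1) obtain u p v where p: "awalk u p v" "X = cls u p v" unfolding Mor_quotient by blast
  with X(2) have "sum_list l = sum_list (map d p)" by (simp only: degree_quotient)
  then have "mset l = mset (map d p)"
    by (rule mset_eq_of_sum_list_axis[OF l colors_axis[OF p(1)]])
  with p(1) obtain q where q: "((u, p, v), (u, q, v)) \<in> R" "map d q = l"
    by (rule reordering_exists)
  with p that[of u q v] R_D(2)[OF q(1)] show ?thesis
    by (simp add: cls_eq_iff)
qed

text \<open>A factorization of a class into degrees \<open>m\<close> and \<open>n\<close> corresponds to a cut of the representative
  whose color order begins with the colors of total degree \<open>n\<close> and ends with those of total degree
  \<open>m\<close>, each in an order chosen beforehand.\<close>

lemma factorization_quotient:
  assumes X: "X \<in> Mor (path_quotient G R)" "quotient_degree d X = n + m"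
  shows "\<exists>!(M, N). M \<in> Mor (path_quotient G R) \<and> N \<in> Mor (path_quotient G R) \<and>
    Dom (path_quotient G R) M = Cod (path_quotient G R) N \<and>
    quotient_degree d M = m \<and> quotient_degree d N = n \<and> X = Comp (path_quotient G R) M N"
proof -
  obtain ln where ln: "set ln \<subseteq> range (\<lambda>i. axis i 1)" "sum_list ln = n"
    using ex_axis_list_of_sum by blast
  obtain lm where lm: "set lm \<subseteq> range (\<lambda>i. axis i 1)" "sum_list lm = m"
    using ex_axis_list_of_sum by blast
  have "quotient_degree d X = sum_list (ln @ lm)" "set (ln @ lm) \<subseteq> range (\<lambda>i. axis i 1)"
    using X(2) ln lm by simp_all
  then obtain u p v where p: "awalk u p v" "X = cls u p v" "map d p = ln @ lm"
    by (rule representative[OF X(1)])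
  from p(3) obtain q r where pq: "p = q @ r" and cols: "map d q = ln" "map d r = lm"
    by (auto simp: map_eq_append_conv)
  from p(1) obtain w where w: "awalk u q w" "awalk w r v"
    unfolding pq awalk_append_ex by blast
  show ?thesis
  proof (rule ex1I[of _ "(cls w r v, cls u q w)"])
    have "cls w r v \<in> Mor (path_quotient G R)" "cls u q w \<in> Mor (path_quotient G R)"
      using w unfolding Mor_quotient by blast+
    then show "case (cls w r v, cls u q w) of (M, N) \<Rightarrow>
        M \<in> Mor (path_quotient G R) \<and> N \<in> Mor (path_quotient G R) \<and>
        Dom (path_quotient G R) M = Cod (path_quotient G R) N \<and>
        quotient_degree d M = m \<and> quotient_degree d N = n \<and> X = Comp (path_quotient G R) M N"
      using w p(2) pq cols ln lm
      by (simp only: prod.case Dom_quotient Cod_quotient degree_quotient Comp_quotient simp_thms)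
  next
    fix MN
    assume MN: "case MN of (M, N) \<Rightarrow>
        M \<in> Mor (path_quotient G R) \<and> N \<in> Mor (path_quotient G R) \<and>
        Dom (path_quotient G R) M = Cod (path_quotient G R) N \<and>
        quotient_degree d M = m \<and> quotient_degree d N = n \<and> X = Comp (path_quotient G R) M N"
    obtain M N where [simp]: "MN = (M, N)" by (cases MN)
    from MN have M: "M \<in> Mor (path_quotient G R)" "quotient_degree d M = sum_list lm"
      and N: "N \<in> Mor (path_quotient G R)" "quotient_degree d N = sum_list ln"
      and eq: "Dom (path_quotient G R) M = Cod (path_quotient G R) N" "X = Comp (path_quotient G R) M N"
      using ln lm by auto
    obtain u' q' w' where q': "awalk u' q' w'" "N = cls u' q' w'" "map d q' = ln"
      using N ln(1) by (rule representative)
    obtain w'' r' v' where r': "awalk w'' r' v'" "M = cls w'' r' v'" "map d r' = lm"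
      using M lm(1) by (rule representative)
    have w'': "w'' = w'" using eq(1) q' r' by (simp only: Dom_quotient Cod_quotient)
    have "cls u p v = cls u' (q' @ r') v'"
      using eq(2) p(2) q' r' w'' by (simp only: Comp_quotient)
    then have R: "((u, p, v), (u', q' @ r', v')) \<in> R"
      using p(1) q'(1) r'(1) w'' awalk_appendI by (subst (asm) cls_eq_iff) auto
    then have uv: "u' = u" "v' = v" by (rule R_D)+
    have "q' @ r' = p"
      by (rule same_colors_imp_eq[of u _ v]) (use R uv p(3) q'(3) r'(3) in simp_all)
    moreover have "length q' = length q" using q'(3) cols(1) by (metis length_map)
    ultimately have qr: "q' = q" "r' = r" using pq by auto
    then have "w' = w" using awalk_unique_range q'(1) w(1) uv by blast
    then show "MN = (cls w r v, cls u q w)" using q'(2) r'(2) qr uv w'' by simp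
  qed
qed

lemma k_graph_quotient:
  assumes "countable (verts G)" "countable (arcs G)"
  shows "k_graph (path_quotient G R) (quotient_degree d)"
proof (intro k_graph.intro small_category_quotient k_graph_axioms.intro)
  show "countable (Obj (path_quotient G R))"
    using assms by (simp add: Obj_quotient)
  have "Mor (path_quotient G R) = (\<lambda>\<kappa>. R `` {\<kappa>}) ` gpaths G"
    by (auto simp: path_quotient_def quotient_def)
  then show "countable (Mor (path_quotient G R))"
    using countable_gpaths[OF assms] by simp
next
  fix v
  assume "v \<in> Obj (path_quotient G R)"
  then show "quotient_degree d (Ident (path_quotient G R) v) = 0"
    by (simp add: Obj_quotient quotient_simps)
next
  fix X Y
  assume "X \<in> Mor (path_quotient G R)" "Y \<in> Mor (path_quotient G R)"
    and eq: "Dom (path_quotient G R) X = Cod (path_quotient G R) Y"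
  then obtain u p v v' q w where Y: "awalk u p v" "Y = cls u p v"
    and X: "awalk v' q w" "X = cls v' q w" unfolding Mor_quotient by blast
  with eq have "v' = v" by (simp add: quotient_simps)
  with X Y show "quotient_degree d (Comp (path_quotient G R) X Y) =
      quotient_degree d X + quotient_degree d Y"
    by (simp only: Comp_quotient awalk_appendI degree_quotient map_append sum_list_append add.commute)
qed (fact factorization_quotient)

end

section \<open>The equivalence of the conditions\<close>

theorem theorem2p3:
  fixes G :: "('v, 'e) pre_digraph"
    and d :: "'e \<Rightarrow> nat ^ 'k::finite"
    and R :: "('v, 'e) path rel"
  assumes "colored_digraph G d"
    and "equiv (gpaths G) R"
    and "rsd_preserving d R"
    and "KG0 G R"
  shows "(KG1 G R \<and> KG2 G d R \<and> KG3 G d R \<and> generated_by_squares G d R \<longleftrightarrow> KG4 G d R) \<and>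
    (KG1 G R \<and> KG2 G d R \<and> KG3 G d R \<and> generated_by_squares G d R \<and>
       countable (verts G) \<and> countable (arcs G) \<longrightarrow>
     k_graph (path_quotient G R) (quotient_degree d))"
proof -
  interpret colored_digraph G d by fact
  interpret path_congruence G d R
    by unfold_locales (use assms in auto)
  have to_KG4: "KG4 G d R" if "KG1 G R" "KG2 G d R" "KG3 G d R" "generated_by_squares G d R"
  proof -
    interpret commuting_squares G d R by unfold_locales (use that in auto)
    show ?thesis using that(4) by (rule generated_imp_KG4)
  qed
  have from_KG4: "KG1 G R \<and> KG2 G d R \<and> KG3 G d R \<and> generated_by_squares G d R" if "KG4 G d R"
  proof -
    interpret reorderable G d R by unfold_locales fact
    show ?thesis using KG1_holds KG2_holds KG3_holds generated_by_squares_holds by blast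
  qed
  have "k_graph (path_quotient G R) (quotient_degree d)"
    if "KG4 G d R" "countable (verts G)" "countable (arcs G)"
  proof -
    interpret reorderable G d R by unfold_locales fact
    show ?thesis using that(2,3) by (rule k_graph_quotient)
  qed
  with to_KG4 from_KG4 show ?thesis by blast
qed

end
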